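(* Consider the affine-quadratic control problem: for $k\in K=\{1,\dots,T\}$, $x_{k+1}=A_kx_k+B_ku_k+c_k$ with $x_1$ given, and minimize $$L(u)=\sum_{k=1}^T\tfrac12\big(x_{k+1}'Q_{k+1}x_{k+1}+u_k'R_ku_k\big),$$ where $Q_{k+1}\ge0$ and $R_k>0$ for all $k\in K$. Then its unique optimal strategies can be written as $$\gamma_k^*(x_k)=-P_kS_{k+1}A_kx_k-P_k(s_{k+1}+S_{k+1}c_k),\qquad k\in K,$$ with $$P_k=(R_k+B_k'S_{k+1}B_k)^{-1}B_k',$$ $$S_k=(A_k-B_kP_kS_{k+1}A_k)'S_{k+1}(A_k-B_kP_kS_{k+1}A_k)+(P_kS_{k+1}A_k)'R_k(P_kS_{k+1}A_k)+Q_k,\qquad S_{T+1}=Q_{T+1},$$ $$s_k=(A_k-B_kP_kS_{k+1}A_k)'\big[s_{k+1}+S_{k+1}\big(c_k-B_kP_k(S_{k+1}c_k+s_{k+1})\big)\big]+(P_kS_{k+1}A_k)'R_kP_k(S_{k+1}c_k+s_{k+1}),\qquad s_{T+1}=0,$$ and the minimum value is $$L(1,x_1)=\tfrac12x_1'S_1x_1+s_1'x_1+q_1,$$ $$q_k=q_{k+1}+\tfrac12\big(c_k-B_kP_k(S_{k+1}c_k+s_{k+1})\big)'S_{k+1}\big(c_k-B_kP_k(S_{k+1}c_k+s_{k+1})\big)+s_{k+1}'\big(c_k-B_kP_k(S_{k+1}c_k+s_{k+1})\big)+\tfrac12\big(P_k(S_{k+1}c_k+s_{k+1})\big)'R_k\big(P_k(S_{k+1}c_k+s_{k+1})\big),\qquad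 q_{T+1}=0.$$
   Context: A prime denotes transpose; for symmetric matrices $>0$ means positive definite and $\ge0$ positive semidefinite. States $x_k\in\mathbb R^p$, controls $u_k\in\mathbb R^m$; $A_k,B_k,c_k,Q_k,R_k$ are given of appropriate dimensions, with $Q_k,R_k$ symmetric. Convention: $Q_1:=0$ (the cost contains no term in $x_1$). Strategies are of feedback type, $u_k=\gamma_k(x_k)$; optimality means: with $V(k,x)$ the minimal cost from stage $k$ onward starting at $x_k=x$ (and $V(T+1,\cdot)=0$), $\gamma_k(x)$ minimizes over $u$ the sum of the stage cost at $k$ and $V(k+1,A_kx+B_ku+c_k)$, for all $k$ and $x$. *)

theory Defs
  imports "HOL-Analysis.Analysis"
begin

definition pos_semidef :: "real^'n^'n \<Rightarrow> bool" where
  "pos_semidef M \<longleftrightarrow> transpose M = M \<and> (\<forall>x. 0 \<le> x \<bullet> (M *v x))"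

definition pos_def :: "real^'n^'n \<Rightarrow> bool" where
  "pos_def M \<longleftrightarrow> transpose M = M \<and> (\<forall>x. x \<noteq> 0 \<longrightarrow> 0 < x \<bullet> (M *v x))"

text \<open>State at absolute time \<open>j\<close> when the system is started at \<open>x\<close> at time \<open>k\<close> and driven by the
  controls \<open>u\<close>; the value at times \<open>j < k\<close> is a dummy.\<close>

primrec state ::
  "(nat \<Rightarrow> real^'p^'p) \<Rightarrow> (nat \<Rightarrow> real^'m^'p) \<Rightarrow> (nat \<Rightarrow> real^'p) \<Rightarrow>
   nat \<Rightarrow> real^'p \<Rightarrow> (nat \<Rightarrow> real^'m) \<Rightarrow> nat \<Rightarrow> real^'p" where
  "state A B c k x u 0 = x"
| "state A B c k x u (Suc j) =
     (if j < k then x else A j *v state A B c k x u j + B j *v u j + c j)"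

text \<open>The argument \<open>y\<close> is the successor state, i.e. the state at time \<open>k + 1\<close>.\<close>

definition stage_cost ::
  "(nat \<Rightarrow> real^'p^'p) \<Rightarrow> (nat \<Rightarrow> real^'m^'m) \<Rightarrow> nat \<Rightarrow> real^'p \<Rightarrow> real^'m \<Rightarrow> real" where
  "stage_cost Q R k y v = 1/2 * (y \<bullet> (Q (k+1) *v y) + v \<bullet> (R k *v v))"

text \<open>For \<open>k = 1\<close> this is the total cost \<open>L(u)\<close>; for \<open>k = T + 1\<close> it is the empty sum.\<close>

definition cost_from ::
  "(nat \<Rightarrow> real^'p^'p) \<Rightarrow> (nat \<Rightarrow> real^'m^'p) \<Rightarrow> (nat \<Rightarrow> real^'p) \<Rightarrow>
   (nat \<Rightarrow> real^'p^'p) \<Rightarrow> (nat \<Rightarrow> real^'m^'m) \<Rightarrow> nat \<Rightarrow>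
   nat \<Rightarrow> real^'p \<Rightarrow> (nat \<Rightarrow> real^'m) \<Rightarrow> real" where
  "cost_from A B c Q R T k x u =
     (\<Sum>j=k..T. stage_cost Q R j (state A B c k x u (j+1)) (u j))"

text \<open>The minimum is required to be attained, so this is not merely an infimum.\<close>

definition is_min_cost ::
  "(nat \<Rightarrow> real^'p^'p) \<Rightarrow> (nat \<Rightarrow> real^'m^'p) \<Rightarrow> (nat \<Rightarrow> real^'p) \<Rightarrow>
   (nat \<Rightarrow> real^'p^'p) \<Rightarrow> (nat \<Rightarrow> real^'m^'m) \<Rightarrow> nat \<Rightarrow>
   nat \<Rightarrow> real^'p \<Rightarrow> real \<Rightarrow> bool" where
  "is_min_cost A B c Q R T k x v \<longleftrightarrow>
     (\<exists>u. is_arg_min (cost_from A B c Q R T k x) (\<lambda>_. True) u \<and>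
          cost_from A B c Q R T k x u = v)"

text \<open>The function \<open>V\<close> is uniquely determined on the times \<open>1, \<dots>, T + 1\<close>, and it vanishes at
  time \<open>T + 1\<close>.\<close>

definition optimal_strategy ::
  "(nat \<Rightarrow> real^'p^'p) \<Rightarrow> (nat \<Rightarrow> real^'m^'p) \<Rightarrow> (nat \<Rightarrow> real^'p) \<Rightarrow>
   (nat \<Rightarrow> real^'p^'p) \<Rightarrow> (nat \<Rightarrow> real^'m^'m) \<Rightarrow> nat \<Rightarrow>
   (nat \<Rightarrow> real^'p \<Rightarrow> real^'m) \<Rightarrow> bool" where
  "optimal_strategy A B c Q R T \<gamma> \<longleftrightarrow>
     (\<exists>V. (\<forall>k\<in>{1..T+1}. \<forall>x. is_min_cost A B c Q R T k x (V k x)) \<and>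
          (\<forall>k\<in>{1..T}. \<forall>x.
             is_arg_min
               (\<lambda>v. stage_cost Q R k (A k *v x + B k *v v + c k) v
                    + V (k+1) (A k *v x + B k *v v + c k))
               (\<lambda>_. True) (\<gamma> k x)))"

end

theory Submission
  imports Defs
begin

text \<open>Backward dynamic programming. The matrix \<open>S k\<close> contains the term \<open>Q k\<close> whereas the cost from
  stage \<open>k\<close> onward does not, so the value function is \<open>1/2 x'(S k - Q k)x + s k \<bullet> x + q k\<close>. Completing the
  square at stage \<open>k\<close> shows that a control \<open>v\<close> exceeds the minimal cost by exactly
  \<open>1/2 (v - v\<^sub>0)'(R k + B k' S (k+1) B k)(v - v\<^sub>0)\<close>, where \<open>v\<^sub>0\<close> is the control prescribed by the feedback law.\<close>

section \<open>Trajectories and the one-step recursion of the cost\<close>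

lemma state_start: "state A B c k x u k = x"
  by (cases k) auto

text \<open>Both trajectories are at the same point at time \<open>k + 1\<close> and obey the same
  recursion afterwards.\<close>

lemma state_shift:
  assumes "k < j"
  shows "state A B c k x u j = state A B c (Suc k) (A k *v x + B k *v u k + c k) u j"
  using assms
proof (induction j)
  case 0
  then show ?case by simp
next
  case (Suc j)
  then show ?case
    by (cases "j = k") (auto simp: state_start)
qed

text \<open>Up to time \<open>k\<close> the state stays at \<open>x\<close>, so controls applied
  earlier never enter.\<close>

lemma state_control_cong:
  assumes "\<And>i. k \<le> i \<Longrightarrow> u i = w i"
  shows "state A B c k x u j = state A B c k x w j"
  using assms by (induction j) auto

lemma cost_from_control_cong:
  assumes "\<And>i. k \<le> i \<Longrightarrow> u i = w i"
  shows "cost_from A B c Q R T k x u = cost_from A B c Q R T k x w"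
  unfolding cost_from_def
  by (intro sum.cong refl) (simp add: assms state_control_cong[OF assms] del: state.simps)

lemma cost_from_step:
  assumes "k \<le> T"
  shows "cost_from A B c Q R T k x u =
    stage_cost Q R k (A k *v x + B k *v u k + c k) (u k)
    + cost_from A B c Q R T (k+1) (A k *v x + B k *v u k + c k) u"
proof -
  have "(\<Sum>j=Suc k..T. stage_cost Q R j (state A B c k x u (j+1)) (u j))
      = (\<Sum>j=Suc k..T. stage_cost Q R j
           (state A B c (k+1) (A k *v x + B k *v u k + c k) u (j+1)) (u j))"
    by (intro sum.cong refl) (simp add: state_shift[of k] del: state.simps)
  moreover have "state A B c k x u (k+1) = A k *v x + B k *v u k + c k"
    by (simp add: state_start)
  ultimately show ?thesis
    unfolding cost_from_def using assms by (simp add: sum.atLeast_Suc_atMost del: state.simps)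
qed

section \<open>Dynamic programming principle\<close>

lemma is_min_cost_unique:
  assumes "is_min_cost A B c Q R T k x v" "is_min_cost A B c Q R T k x w"
  shows "v = w"
  using assms unfolding is_min_cost_def is_arg_min_linorder by (meson order_antisym)

text \<open>Verification argument by induction downwards from \<open>T + 1\<close>:
  \<open>lower\<close> bounds the cost of every control sequence from below, and concatenating the
  controls from \<open>attained\<close> reaches the bound.\<close>

lemma is_min_cost_bellman:
  assumes final: "\<And>x. V (T+1) x = 0"
    and lower: "\<And>k x v. k \<in> {1..T} \<Longrightarrow>
      V k x \<le> stage_cost Q R k (A k *v x + B k *v v + c k) v
               + V (k+1) (A k *v x + B k *v v + c k)"
    and attained: "\<And>k x. k \<in> {1..T} \<Longrightarrow>
      \<exists>v. stage_cost Q R k (A k *v x + B k *v v + c k) v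
           + V (k+1) (A k *v x + B k *v v + c k) = V k x"
    and k: "k \<in> {1..T+1}"
  shows "is_min_cost A B c Q R T k x (V k x)"
proof -
  let ?C = "cost_from A B c Q R T"
  have "k \<le> T+1" using k by simp
  then have "\<forall>x. (\<forall>u. V k x \<le> ?C k x u) \<and> (\<exists>u. ?C k x u = V k x)"
  proof (induction rule: inc_induct)
    case base
    then show ?case by (simp add: final[simplified] cost_from_def)
  next
    case (step j)
    then have j: "j \<in> {1..T}" using k by simp
    show ?case
    proof (intro allI conjI)
      fix x u
      let ?y = "A j *v x + B j *v u j + c j"
      have "V (j+1) ?y \<le> ?C (j+1) ?y u"
        using step.IH by simp
      then show "V j x \<le> ?C j x u"
        using lower[OF j, of x "u j"] cost_from_step[of j T A B c Q R x u] j by simp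
    next
      fix x
      obtain v where v: "stage_cost Q R j (A j *v x + B j *v v + c j) v
          + V (j+1) (A j *v x + B j *v v + c j) = V j x"
        using attained[OF j] by blast
      let ?y = "A j *v x + B j *v v + c j"
      obtain u where u: "?C (j+1) ?y u = V (j+1) ?y"
        using step.IH by auto
      \<comment> \<open>Prepending \<open>v\<close> to a sequence optimal from \<open>j + 1\<close>
        changes it only at time \<open>j\<close>, which the later cost does not see.\<close>
      have "?C (j+1) ?y (u(j := v)) = ?C (j+1) ?y u"
        by (rule cost_from_control_cong) simp
      then have "?C j x (u(j := v)) = V j x"
        using cost_from_step[of j T A B c Q R x "u(j := v)"] j u v by simp
      then show "\<exists>u. ?C j x u = V j x" by blast
    qed
  qed
  then show ?thesis
    unfolding is_min_cost_def is_arg_min_linorder by metis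
qed

text \<open>The definition only asserts that some value function exists. As minimal costs are
  unique, it agrees with \<open>V\<close> on the times that matter, so its minimizers are those of
  \<open>V\<close>.\<close>

lemma optimal_strategy_unique:
  assumes V: "\<And>k x. k \<in> {1..T+1} \<Longrightarrow> is_min_cost A B c Q R T k x (V k x)"
    and minimizer: "\<And>k x v. k \<in> {1..T} \<Longrightarrow>
      is_arg_min (\<lambda>v. stage_cost Q R k (A k *v x + B k *v v + c k) v
                    + V (k+1) (A k *v x + B k *v v + c k)) (\<lambda>_. True) v
      \<longleftrightarrow> v = g k x"
  shows "optimal_strategy A B c Q R T \<gamma> \<longleftrightarrow> (\<forall>k\<in>{1..T}. \<forall>x. \<gamma> k x = g k x)"
proof
  assume "optimal_strategy A B c Q R T \<gamma>"
  then obtain W where W: "\<And>k x. k \<in> {1..T+1} \<Longrightarrow> is_min_cost A B c Q R T k x (W k x)"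
    and W': "\<And>k x. k \<in> {1..T} \<Longrightarrow>
      is_arg_min (\<lambda>v. stage_cost Q R k (A k *v x + B k *v v + c k) v
                    + W (k+1) (A k *v x + B k *v v + c k)) (\<lambda>_. True) (\<gamma> k x)"
    unfolding optimal_strategy_def by blast
  show "\<forall>k\<in>{1..T}. \<forall>x. \<gamma> k x = g k x"
  proof (intro ballI allI)
    fix k x assume k: "k \<in> {1..T}"
    then have "W (k+1) y = V (k+1) y" for y
      by (intro is_min_cost_unique[OF W V]) auto
    then show "\<gamma> k x = g k x"
      using W'[OF k, of x] minimizer[OF k] by simp
  qed
next
  assume "\<forall>k\<in>{1..T}. \<forall>x. \<gamma> k x = g k x"
  then show "optimal_strategy A B c Q R T \<gamma>"
    unfolding optimal_strategy_def using V minimizer by (intro exI[of _ V]) auto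
qed

lemma is_arg_min_unique_iff:
  fixes f :: "'a \<Rightarrow> real"
  assumes "\<And>v. v \<noteq> a \<Longrightarrow> f a < f v"
  shows "is_arg_min f (\<lambda>_. True) v \<longleftrightarrow> v = a"
  unfolding is_arg_min_linorder using assms by (metis less_eq_real_def linorder_not_less)

section \<open>Symmetric and definite matrices\<close>

lemma inner_matrix_commute:
  fixes M :: "real^'n^'n"
  assumes "transpose M = M"
  shows "x \<bullet> (M *v y) = y \<bullet> (M *v x)"
  by (metis assms dot_lmul_matrix inner_commute transpose_matrix_vector)

lemma inner_vector_matrix:
  fixes M :: "real^'n^'m"
  shows "x \<bullet> (y v* M) = (M *v x) \<bullet> y"
  by (metis dot_lmul_matrix inner_commute)

lemma transpose_add: "transpose (M + N) = transpose M + transpose N"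
  for M N :: "real^'n^'m"
  by (simp add: transpose_def vec_eq_iff)

lemma pos_semidef_add:
  assumes "pos_semidef M" "pos_semidef N"
  shows "pos_semidef (M + N)"
  using assms
  by (simp add: pos_semidef_def transpose_add matrix_vector_mult_add_rdistrib inner_add_right)

lemma pos_def_imp_pos_semidef: "pos_def M \<Longrightarrow> pos_semidef M"
  unfolding pos_def_def pos_semidef_def
  by (metis inner_zero_left less_eq_real_def)

lemma pos_semidef_congruence:
  fixes M :: "real^'n^'n" and N :: "real^'m^'n"
  assumes "pos_semidef M"
  shows "pos_semidef (transpose N ** M ** N)"
  using assms
  by (simp add: pos_semidef_def matrix_transpose_mul matrix_mul_assoc inner_vector_matrix
      flip: matrix_vector_mul_assoc)

lemma pos_def_add_pos_semidef:
  assumes "pos_def M" "pos_semidef N"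
  shows "pos_def (M + N)"
  using assms
  by (simp add: pos_def_def pos_semidef_def transpose_add matrix_vector_mult_add_rdistrib
      inner_add_right add_pos_nonneg)

text \<open>A nonzero kernel vector would make the quadratic form vanish; a square matrix with
  trivial kernel is invertible.\<close>

lemma pos_def_invertible:
  fixes M :: "real^'n^'n"
  assumes "pos_def M"
  shows "invertible M"
proof -
  have "x = 0" if "M *v x = 0" for x
    using assms that unfolding pos_def_def by fastforce
  then show ?thesis
    using invertible_left_inverse matrix_left_invertible_ker by blast
qed

lemma mult_matrix_inv:
  assumes "invertible M"
  shows "M ** matrix_inv M = mat 1"
  using someI_ex[OF assms[unfolded invertible_def]] by (simp add: matrix_inv_def)

section \<open>Quadratic identities\<close>

text \<open>The equation for \<open>v0\<close> says that the gradient in \<open>v\<close> vanishes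
  there, so the terms linear in \<open>v - v0\<close> cancel. In the application \<open>a\<close> is
  the uncontrolled successor \<open>A k *v x + c k\<close>.\<close>

lemma complete_square:
  fixes S :: "real^'p^'p" and R :: "real^'m^'m" and B :: "real^'m^'p"
  assumes S: "transpose S = S" and R: "transpose R = R"
    and v0: "(R + transpose B ** S ** B) *v v0 = - (transpose B *v (S *v a + s))"
  shows "1/2 * (v \<bullet> (R *v v)) + 1/2 * ((a + B *v v) \<bullet> (S *v (a + B *v v))) + s \<bullet> (a + B *v v)
       = 1/2 * (v0 \<bullet> (R *v v0)) + 1/2 * ((a + B *v v0) \<bullet> (S *v (a + B *v v0))) + s \<bullet> (a + B *v v0)
         + 1/2 * ((v - v0) \<bullet> ((R + transpose B ** S ** B) *v (v - v0)))"
proof -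
  define h where "h = v - v0"
  have v: "v = v0 + h" by (simp add: h_def)
  have "h \<bullet> ((R + transpose B ** S ** B) *v v0) = - (h \<bullet> (transpose B *v (S *v a + s)))"
    by (simp add: v0)
  then have cross: "h \<bullet> (R *v v0) + (B *v h) \<bullet> (S *v (B *v v0)) + (B *v h) \<bullet> (S *v a) + s \<bullet> (B *v h) = 0"
    by (simp add: matrix_vector_mult_add_rdistrib inner_add_right inner_vector_matrix inner_commute[of s]
        flip: matrix_vector_mul_assoc)
  have sq: "h \<bullet> ((R + transpose B ** S ** B) *v h) = h \<bullet> (R *v h) + (B *v h) \<bullet> (S *v (B *v h))"
    by (simp add: matrix_vector_mult_add_rdistrib inner_add_right inner_vector_matrix
        flip: matrix_vector_mul_assoc)
  note comm = inner_matrix_commute[OF R, of v0 h] inner_matrix_commute[OF S, of a "B *v h"]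
    inner_matrix_commute[OF S, of "B *v v0" "B *v h"]
  show ?thesis
    using cross
    by (simp add: h_def[symmetric] sq) (simp add: v matrix_vector_right_distrib inner_add_left inner_add_right
        comm add_divide_distrib algebra_simps)
qed

text \<open>Symmetry merges the two cross terms. The three summands feed the recursions for
  \<open>S\<close>, \<open>s\<close> and \<open>q\<close> respectively.\<close>

lemma affine_quadratic_expand:
  fixes S :: "real^'n^'n" and F :: "real^'p^'n"
  assumes "transpose S = S"
  shows "(F *v x + d) \<bullet> (S *v (F *v x + d))
    = x \<bullet> ((transpose F ** S ** F) *v x) + 2 * ((transpose F *v (S *v d)) \<bullet> x) + d \<bullet> (S *v d)"
  using inner_matrix_commute[OF assms, of d "F *v x"]
  by (simp add: matrix_vector_right_distrib inner_add_left inner_add_right inner_vector_matrix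
      inner_commute[of _ x] flip: matrix_vector_mul_assoc)

theorem proposition2:
  fixes A :: "nat \<Rightarrow> real^'p^'p" and B :: "nat \<Rightarrow> real^'m^'p" and c :: "nat \<Rightarrow> real^'p"
    and Q :: "nat \<Rightarrow> real^'p^'p" and R :: "nat \<Rightarrow> real^'m^'m"
    and P :: "nat \<Rightarrow> real^'p^'m" and S :: "nat \<Rightarrow> real^'p^'p"
    and s :: "nat \<Rightarrow> real^'p" and q :: "nat \<Rightarrow> real"
    and T :: nat and x1 :: "real^'p"
  assumes Q1: "Q 1 = 0"
    and Q_psd: "\<And>k. k \<in> {1..T} \<Longrightarrow> pos_semidef (Q (k+1))"
    and R_pd: "\<And>k. k \<in> {1..T} \<Longrightarrow> pos_def (R k)"
    and P_eq: "\<And>k. k \<in> {1..T} \<Longrightarrow>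
      P k = matrix_inv (R k + transpose (B k) ** S (k+1) ** B k) ** transpose (B k)"
    and S_final: "S (T+1) = Q (T+1)"
    and S_eq: "\<And>k. k \<in> {1..T} \<Longrightarrow>
      S k = transpose (A k - B k ** P k ** S (k+1) ** A k) ** S (k+1)
              ** (A k - B k ** P k ** S (k+1) ** A k)
          + transpose (P k ** S (k+1) ** A k) ** R k ** (P k ** S (k+1) ** A k)
          + Q k"
    and s_final: "s (T+1) = 0"
    and s_eq: "\<And>k. k \<in> {1..T} \<Longrightarrow>
      s k = transpose (A k - B k ** P k ** S (k+1) ** A k)
              *v (s (k+1) + S (k+1) *v (c k - (B k ** P k) *v (S (k+1) *v c k + s (k+1))))
          + (transpose (P k ** S (k+1) ** A k) ** R k ** P k) *v (S (k+1) *v c k + s (k+1))"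
    and q_final: "q (T+1) = 0"
    and q_eq: "\<And>k. k \<in> {1..T} \<Longrightarrow>
      q k = q (k+1)
          + 1/2 * ((c k - (B k ** P k) *v (S (k+1) *v c k + s (k+1)))
                   \<bullet> (S (k+1) *v (c k - (B k ** P k) *v (S (k+1) *v c k + s (k+1)))))
          + s (k+1) \<bullet> (c k - (B k ** P k) *v (S (k+1) *v c k + s (k+1)))
          + 1/2 * ((P k *v (S (k+1) *v c k + s (k+1)))
                   \<bullet> (R k *v (P k *v (S (k+1) *v c k + s (k+1)))))"
  shows "(\<forall>k\<in>{1..T}. invertible (R k + transpose (B k) ** S (k+1) ** B k))
    \<and> (\<forall>\<gamma>. optimal_strategy A B c Q R T \<gamma> \<longleftrightarrow>
          (\<forall>k\<in>{1..T}. \<forall>x. \<gamma> k x = - ((P k ** S (k+1) ** A k) *v x)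
                                   - P k *v (s (k+1) + S (k+1) *v c k)))
    \<and> is_min_cost A B c Q R T 1 x1 (1/2 * (x1 \<bullet> (S 1 *v x1)) + s 1 \<bullet> x1 + q 1)"
proof -
  \<comment> \<open>For \<open>k\<close> in \<open>{1..T}\<close>, \<open>M k\<close> is the Hessian
    in \<open>v\<close> of the objective \<open>?J k x v\<close> below, and \<open>g k x\<close> its
    critical point.\<close>
  define M where "M k = R k + transpose (B k) ** S (k+1) ** B k" for k
  define g where "g k x = - ((P k ** S (k+1) ** A k) *v x) - P k *v (s (k+1) + S (k+1) *v c k)" for k x
  define V where "V k x = 1/2 * (x \<bullet> ((S k - Q k) *v x)) + s k \<bullet> x + q k" for k x
  let ?J = "\<lambda>k x v. stage_cost Q R k (A k *v x + B k *v v + c k) v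
      + V (k+1) (A k *v x + B k *v v + c k)"

  \<comment> \<open>The assumption starts at \<open>Q 2\<close>; the convention
    \<open>Q 1 = 0\<close> supplies the missing index.\<close>
  have Q_psd': "pos_semidef (Q k)" if "k \<in> {1..T+1}" for k
  proof (cases "k = 1")
    case True
    then show ?thesis using Q1 by (simp add: pos_semidef_def) (simp add: transpose_def vec_eq_iff)
  next
    case False
    then have "k - 1 \<in> {1..T}" "k - 1 + 1 = k" using that by auto
    then show ?thesis using Q_psd[of "k - 1"] by simp
  qed
  \<comment> \<open>Backward induction: the recursion writes \<open>S k\<close> as two congruences
    of semidefinite matrices plus \<open>Q k\<close>.\<close>
  have S_psd: "pos_semidef (S k)" if "k \<in> {1..T+1}" for k
  proof -
    have "k \<le> T+1" using that by simp
    then show ?thesis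
    proof (induction rule: inc_induct)
      case base
      then show ?case using Q_psd' by (simp add: S_final[simplified])
    next
      case (step j)
      then have j: "j \<in> {1..T}" using that by simp
      have "pos_semidef (S (j+1))" using step.IH by simp
      moreover have "pos_semidef (R j)" using R_pd[OF j] by (rule pos_def_imp_pos_semidef)
      moreover have "pos_semidef (Q j)" using Q_psd' j by simp
      ultimately show ?case
        unfolding S_eq[OF j] by (intro pos_semidef_add pos_semidef_congruence)
    qed
  qed
  have M_pd: "pos_def (M k)" if "k \<in> {1..T}" for k
    unfolding M_def using that S_psd[of "k+1"] R_pd[OF that]
    by (intro pos_def_add_pos_semidef pos_semidef_congruence) auto
  have M_inv: "invertible (M k)" if "k \<in> {1..T}" for k
    using M_pd[OF that] by (rule pos_def_invertible)

  \<comment> \<open>The stage cost charges \<open>Q (k+1)\<close> at the successor state, which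
    cancels the \<open>- Q (k+1)\<close> in \<open>V (k+1)\<close> and leaves
    \<open>S (k+1)\<close>.\<close>
  have J_form: "?J k x v = 1/2 * (v \<bullet> (R k *v v))
      + 1/2 * ((A k *v x + c k + B k *v v) \<bullet> (S (k+1) *v (A k *v x + c k + B k *v v)))
      + s (k+1) \<bullet> (A k *v x + c k + B k *v v) + q (k+1)" for k x v
  proof -
    have "A k *v x + B k *v v + c k = A k *v x + c k + B k *v v" by simp
    then show ?thesis
      by (simp only:) (simp add: stage_cost_def V_def matrix_vector_mult_diff_rdistrib
          inner_diff_right algebra_simps)
  qed

  \<comment> \<open>Under feedback the successor is \<open>F *v x + d\<close> and the control is
    \<open>- (G *v x + r)\<close>. Expanding both quadratic forms in \<open>x\<close> and matching
    coefficients gives exactly the recursions for \<open>S\<close>, \<open>s\<close> and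
    \<open>q\<close>.\<close>
  have J_g: "?J k x (g k x) = V k x" if k: "k \<in> {1..T}" for k x
  proof -
    define F where "F = A k - B k ** P k ** S (k+1) ** A k"
    define G where "G = P k ** S (k+1) ** A k"
    define r where "r = P k *v (S (k+1) *v c k + s (k+1))"
    define d where "d = c k - (B k ** P k) *v (S (k+1) *v c k + s (k+1))"
    have g: "g k x = - (G *v x + r)"
      by (simp add: g_def G_def r_def add.commute)
    have y: "A k *v x + c k + B k *v g k x = F *v x + d"
      by (simp add: g F_def G_def d_def r_def matrix_vector_mult_diff_rdistrib
          matrix_vector_mult_diff_distrib matrix_vector_right_distrib vec.neg matrix_mul_assoc
          matrix_vector_mul_assoc)
    have SR: "transpose (S (k+1)) = S (k+1)" "transpose (R k) = R k"
      using S_psd[of "k+1"] R_pd[OF k] k by (auto simp: pos_semidef_def pos_def_def)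
    have Sk: "S k - Q k = transpose F ** S (k+1) ** F + transpose G ** R k ** G"
      using S_eq[OF k] by (simp add: F_def G_def)
    have sk: "s k = transpose F *v (s (k+1) + S (k+1) *v d) + transpose G *v (R k *v r)"
      using s_eq[OF k] by (simp add: F_def G_def d_def r_def matrix_vector_mul_assoc matrix_mul_assoc)
    have qk: "q k = q (k+1) + 1/2 * (d \<bullet> (S (k+1) *v d)) + s (k+1) \<bullet> d + 1/2 * (r \<bullet> (R k *v r))"
      using q_eq[OF k] by (simp add: d_def r_def)
    have "(transpose F *v s (k+1)) \<bullet> x = s (k+1) \<bullet> (F *v x)"
      by (metis inner_commute inner_vector_matrix transpose_matrix_vector)
    \<comment> \<open>The sign of the control drops out of its quadratic form.\<close>
    moreover have "g k x \<bullet> (R k *v g k x) = (G *v x + r) \<bullet> (R k *v (G *v x + r))"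
      by (simp add: g vec.neg del: minus_add_distrib)
    then have "g k x \<bullet> (R k *v g k x) = x \<bullet> ((transpose G ** R k ** G) *v x)
        + 2 * ((transpose G *v (R k *v r)) \<bullet> x) + r \<bullet> (R k *v r)"
      by (simp only: affine_quadratic_expand[OF SR(2)])
    ultimately show ?thesis
      unfolding J_form[of k x "g k x", unfolded y] unfolding V_def Sk sk qk
        affine_quadratic_expand[OF SR(1), of F x d]
      by (simp add: matrix_vector_mult_add_rdistrib matrix_vector_right_distrib
          inner_add_left inner_add_right algebra_simps)
  qed

  have J_eq: "?J k x v = V k x + 1/2 * ((v - g k x) \<bullet> (M k *v (v - g k x)))"
    if k: "k \<in> {1..T}" for k x v
  proof -
    have "g k x = - (P k *v (S (k+1) *v (A k *v x + c k) + s (k+1)))"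
      by (simp add: g_def matrix_vector_right_distrib matrix_vector_mul_assoc matrix_mul_assoc)
    \<comment> \<open>Multiplying by \<open>M k\<close> undoes the inverse in \<open>P k\<close>,
      which turns the feedback law into the critical point equation of
      \<open>complete_square\<close>.\<close>
    moreover have "M k *v (P k *v z) = transpose (B k) *v z" for z
    proof -
      have "M k ** P k = transpose (B k)"
        using P_eq[OF k] mult_matrix_inv[OF M_inv[OF k]] by (simp add: M_def matrix_mul_assoc)
      then show ?thesis by (simp add: matrix_vector_mul_assoc)
    qed
    ultimately have "M k *v g k x = - (transpose (B k) *v (S (k+1) *v (A k *v x + c k) + s (k+1)))"
      by (simp add: vec.neg)
    then have gk: "(R k + transpose (B k) ** S (k+1) ** B k) *v g k x
        = - (transpose (B k) *v (S (k+1) *v (A k *v x + c k) + s (k+1)))"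
      by (simp only: M_def)
    have SR: "transpose (S (k+1)) = S (k+1)" "transpose (R k) = R k"
      using S_psd[of "k+1"] R_pd[OF k] k by (auto simp: pos_semidef_def pos_def_def)
    have "?J k x v = ?J k x (g k x) + 1/2 * ((v - g k x) \<bullet> (M k *v (v - g k x)))"
      unfolding J_form M_def using complete_square[OF SR gk, of v] by linarith
    then show ?thesis by (simp only: J_g[OF k])
  qed
  \<comment> \<open>Definiteness of \<open>M k\<close> makes the excess strictly positive; this
    yields uniqueness of the strategy.\<close>
  have J_gt: "V k x < ?J k x v" if "k \<in> {1..T}" "v \<noteq> g k x" for k x v
    unfolding J_eq[OF that(1)] using M_pd[OF that(1)] that(2) by (simp add: pos_def_def)

  have V_min: "is_min_cost A B c Q R T k x (V k x)" if "k \<in> {1..T+1}" for k x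
  proof (rule is_min_cost_bellman[OF _ _ _ that])
    \<comment> \<open>At the final time \<open>S\<close> and \<open>Q\<close> coincide, so the
      quadratic part vanishes along with \<open>s\<close> and \<open>q\<close>.\<close>
    show "V (T+1) x = 0" for x
      by (simp add: V_def S_final[simplified] s_final[simplified] q_final[simplified])
    show "V k x \<le> ?J k x v" if "k \<in> {1..T}" for k x v
      using J_gt[OF that] J_g[OF that] by (metis less_eq_real_def)
    show "\<exists>v. ?J k x v = V k x" if "k \<in> {1..T}" for k x
      using J_g[OF that] by blast
  qed
  have "is_arg_min (?J k x) (\<lambda>_. True) v \<longleftrightarrow> v = g k x" if k: "k \<in> {1..T}" for k x v
    by (rule is_arg_min_unique_iff) (metis J_g[OF k] J_gt[OF k])
  then have "optimal_strategy A B c Q R T \<gamma> \<longleftrightarrow> (\<forall>k\<in>{1..T}. \<forall>x. \<gamma> k x = g k x)" for \<gamma>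
    by (intro optimal_strategy_unique[OF V_min])
  \<comment> \<open>Since \<open>Q 1 = 0\<close>, the correction by \<open>Q\<close> disappears at
    the initial time.\<close>
  moreover have "V 1 x1 = 1/2 * (x1 \<bullet> (S 1 *v x1)) + s 1 \<bullet> x1 + q 1"
    using Q1 by (simp add: V_def)
  ultimately show ?thesis
    using M_inv V_min[of 1 x1] by (simp add: M_def g_def)
qed

end
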